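(* Hechler forcing $\mathbb{D}$ satisfies property $( ** )$.
   Context: Hechler forcing $\mathbb{D}$: conditions are pairs $(s,f)$ with $s\in\omega^{<\omega}$, $f\in\omega^\omega$ strictly increasing, $s\subseteq f$; $(s,f)\le(t,g)$ iff $s\supseteq t$ and $f(n)\ge g(n)$ for all $n$. An $\omega$-predictor is a pair $\pi=(D_\pi,(\pi_n;\,n\in D_\pi))$ with $D_\pi\subseteq\omega$ infinite and $\pi_n:\omega^n\to\omega$; $\pi$ predicts $f\in\omega^\omega$ iff $f(n)=\pi_n(f\restriction n)$ for all but finitely many $n\in D_\pi$, otherwise $f$ evades $\pi$. A forcing notion $\mathbb{P}$ (in ground model $V$) satisfies $( ** )$ iff: whenever $F\in V$, $F\subseteq\omega^\omega\cap V$ is a family of functions below the identity (i.e. $f(n)\le n$ for all $n$ and $f\in F$) such that for every countable family $\Pi$ of predictors (in $V$) some $f\in F$ evades all $\pi\in\Pi$, and $\langle\breve\pi_n;\,n\in\omega\rangle$ is a sequence of $\mathbb{P}$-names for predictors, there is a sequence $\langle\pi_n;\,n\in\omega\rangle\in V$ of predictors such that every $f\in F$ which evades all $\pi_n$ satisfies $\Vdash_{\mathbb{P}}$ "$f$ evades all $\breve\pi_n$". *)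

theory Defs
  imports "HOL-Library.Countable_Set" "HOL-Library.Sublist"
begin

text \<open>The HOL universe plays the role of the ground model \<open>V\<close>; the set \<open>\<omega>\<^sup>\<omega> \<inter> V\<close>
  is the type \<^typ>\<open>nat \<Rightarrow> nat\<close>, and \<open>\<omega>\<^sup>n\<close> is the set of lists of
  naturals of length \<open>n\<close>.\<close>

definition restr :: "(nat \<Rightarrow> nat) \<Rightarrow> nat \<Rightarrow> nat list" where
  "restr f n = map f [0..<n]"

subsection \<open>Predictors\<close>

text \<open>Since a list determines its length, the family \<open>(\<pi>\<^sub>n; n \<in> D)\<close> is a single function on lists;
  its values on lists whose length is not in \<open>D\<close> are never used.\<close>

type_synonym predictor = "nat set \<times> (nat list \<Rightarrow> nat)"

definition is_predictor :: "predictor \<Rightarrow> bool" where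
  "is_predictor \<pi> \<longleftrightarrow> infinite (fst \<pi>)"

definition predicts :: "predictor \<Rightarrow> (nat \<Rightarrow> nat) \<Rightarrow> bool" where
  "predicts \<pi> f \<longleftrightarrow> finite {n \<in> fst \<pi>. f n \<noteq> snd \<pi> (restr f n)}"

definition evades :: "(nat \<Rightarrow> nat) \<Rightarrow> predictor \<Rightarrow> bool" where
  "evades f \<pi> \<longleftrightarrow> \<not> predicts \<pi> f"

subsection \<open>Names and the forcing relation\<close>

text \<open>A name for a subset of a ground model set (here: a type \<open>'a\<close>) is a set of pairs
  \<open>(a, p)\<close>, standing for the name whose elements are the pairs of the canonical name of \<open>a\<close>
  and the condition \<open>p\<close>. A name for a predictor \<open>(D, (\<pi>\<^sub>n; n \<in> D))\<close> consists of a name for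
  \<open>D\<close> and a name for the union of the graphs of the \<open>\<pi>\<^sub>n\<close>.\<close>

type_synonym ('a, 'p) set_name = "('a \<times> 'p) set"
type_synonym 'p predictor_name = "(nat, 'p) set_name \<times> (nat list \<times> nat, 'p) set_name"

text \<open>A sentence of the forcing language is represented by the predicate \<open>\<lambda>p. p \<tturnstile> \<phi>\<close>.\<close>

type_synonym 'p sentence = "'p \<Rightarrow> bool"

locale forcing_notion =
  fixes P :: "'p set" and le :: "'p \<Rightarrow> 'p \<Rightarrow> bool"  (infix "\<preceq>" 50)
  assumes nonempty: "P \<noteq> {}"
    and le_refl: "p \<in> P \<Longrightarrow> p \<preceq> p"
    and le_trans: "\<lbrakk>p \<in> P; q \<in> P; r \<in> P; p \<preceq> q; q \<preceq> r\<rbrakk> \<Longrightarrow> p \<preceq> r"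
begin

definition is_set_name :: "('a, 'p) set_name \<Rightarrow> bool" where
  "is_set_name \<tau> \<longleftrightarrow> \<tau> \<subseteq> UNIV \<times> P"

text \<open>\<open>p\<close> forces \<open>a \<in> \<tau>\<close> iff the conditions lying below some \<open>t\<close> with \<open>(a, t) \<in> \<tau>\<close> are
  dense below \<open>p\<close>.\<close>

definition F_mem :: "'a \<Rightarrow> ('a, 'p) set_name \<Rightarrow> 'p sentence" where
  "F_mem a \<tau> p \<longleftrightarrow> (\<forall>q\<in>P. q \<preceq> p \<longrightarrow> (\<exists>r\<in>P. r \<preceq> q \<and> (\<exists>t. (a, t) \<in> \<tau> \<and> r \<preceq> t)))"

text \<open>Absolute statements about objects of the ground model.\<close>

definition F_ground :: "bool \<Rightarrow> 'p sentence" where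
  "F_ground b p \<longleftrightarrow> b"

definition F_not :: "'p sentence \<Rightarrow> 'p sentence" where
  "F_not \<phi> p \<longleftrightarrow> \<not> (\<exists>q\<in>P. q \<preceq> p \<and> \<phi> q)"

definition F_and :: "'p sentence \<Rightarrow> 'p sentence \<Rightarrow> 'p sentence" where
  "F_and \<phi> \<psi> p \<longleftrightarrow> \<phi> p \<and> \<psi> p"

text \<open>Quantification over a ground model set such as \<open>\<omega>\<close> or \<open>\<omega>\<^sup>n\<close>, so only canonical names
  need to be considered.\<close>

definition F_all :: "('a \<Rightarrow> 'p sentence) \<Rightarrow> 'p sentence" where
  "F_all \<Phi> p \<longleftrightarrow> (\<forall>x. \<Phi> x p)"

definition F_imp :: "'p sentence \<Rightarrow> 'p sentence \<Rightarrow> 'p sentence" where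
  "F_imp \<phi> \<psi> = F_not (F_and \<phi> (F_not \<psi>))"

definition F_ex :: "('a \<Rightarrow> 'p sentence) \<Rightarrow> 'p sentence" where
  "F_ex \<Phi> = F_not (F_all (\<lambda>x. F_not (\<Phi> x)))"

definition F_ex1 :: "('a \<Rightarrow> 'p sentence) \<Rightarrow> 'p sentence" where
  "F_ex1 \<Phi> = F_ex (\<lambda>x. F_and (\<Phi> x) (F_all (\<lambda>y. F_imp (\<Phi> y) (F_ground (y = x)))))"

definition forced :: "'p sentence \<Rightarrow> bool" where
  "forced \<phi> \<longleftrightarrow> (\<forall>p\<in>P. \<phi> p)"

definition F_is_predictor :: "'p predictor_name \<Rightarrow> 'p sentence" where
  "F_is_predictor \<pi> =
     F_and
       (F_all (\<lambda>m. F_ex (\<lambda>n. F_and (F_ground (m \<le> n)) (F_mem n (fst \<pi>)))))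
       (F_all (\<lambda>\<sigma>. F_imp (F_mem (length \<sigma>) (fst \<pi>)) (F_ex1 (\<lambda>k. F_mem (\<sigma>, k) (snd \<pi>)))))"

text \<open>The pair \<open>(f\<restriction>n, f(n))\<close> belongs to the graph for all but finitely many \<open>n \<in> D\<close>.\<close>

definition F_predicts :: "'p predictor_name \<Rightarrow> (nat \<Rightarrow> nat) \<Rightarrow> 'p sentence" where
  "F_predicts \<pi> f =
     F_ex (\<lambda>m. F_all (\<lambda>n. F_imp (F_and (F_ground (m \<le> n)) (F_mem n (fst \<pi>)))
                                (F_mem (restr f n, f n) (snd \<pi>))))"

definition F_evades :: "(nat \<Rightarrow> nat) \<Rightarrow> 'p predictor_name \<Rightarrow> 'p sentence" where
  "F_evades f \<pi> = F_not (F_predicts \<pi> f)"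

definition is_predictor_name :: "'p predictor_name \<Rightarrow> bool" where
  "is_predictor_name \<pi> \<longleftrightarrow>
     is_set_name (fst \<pi>) \<and> is_set_name (snd \<pi>) \<and> forced (F_is_predictor \<pi>)"

definition star_star :: bool where
  "star_star \<longleftrightarrow>
     (\<forall>(F :: (nat \<Rightarrow> nat) set) (\<pi>' :: nat \<Rightarrow> 'p predictor_name).
        (\<forall>f\<in>F. \<forall>n. f n \<le> n) \<longrightarrow>
        (\<forall>\<Pi>. countable \<Pi> \<and> (\<forall>\<pi>\<in>\<Pi>. is_predictor \<pi>) \<longrightarrow> (\<exists>f\<in>F. \<forall>\<pi>\<in>\<Pi>. evades f \<pi>)) \<longrightarrow>
        (\<forall>n. is_predictor_name (\<pi>' n)) \<longrightarrow>
        (\<exists>\<pi> :: nat \<Rightarrow> predictor.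
           (\<forall>n. is_predictor (\<pi> n)) \<and>
           (\<forall>f\<in>F. (\<forall>n. evades f (\<pi> n)) \<longrightarrow> forced (F_all (\<lambda>n. F_evades f (\<pi>' n))))))"

end

subsection \<open>Hechler forcing\<close>

definition Hechler :: "(nat list \<times> (nat \<Rightarrow> nat)) set" where
  "Hechler = {(s, f). strict_mono f \<and> (\<forall>i<length s. s ! i = f i)}"

definition Hechler_le :: "nat list \<times> (nat \<Rightarrow> nat) \<Rightarrow> nat list \<times> (nat \<Rightarrow> nat) \<Rightarrow> bool" where
  "Hechler_le p q \<longleftrightarrow> prefix (fst q) (fst p) \<and> (\<forall>n. snd q n \<le> snd p n)"

interpretation Hechler: forcing_notion Hechler Hechler_le
proof
  have "([], id) \<in> Hechler"
    by (simp add: Hechler_def strict_mono_def)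
  then show "Hechler \<noteq> {}"
    by blast
qed (auto simp: Hechler_le_def intro: prefix_order.trans le_trans)

end

(* Functions below the identity meet the n-th level in a finite set, so a prediction function
   restricted to that level and truncated at n + 1 takes only finitely many values. Hence, if no
   condition with stem s forbids n from lying in D, then for one of these finitely many values
   no condition with stem s forbids it either (two conditions with the same stem are compatible),
   and every f which some condition with stem s forces to be predicted from some m \<le> n on agrees with
   that value at n.

   If this happens for infinitely many n, the stem s alone yields a ground model predictor. If it
   happens for no n \<ge> k, call s bad. Either some bad stem t has extensions of a common length,
   with arbitrarily large first new entry, which are not bad; then the numbers n which
   witness this tend to infinity and again yield a ground model predictor. Or there is none, and
   then a fusion produces a condition all of whose extensions have bad stems, so that it
   forces D to be bounded, a contradiction. This replaces the usual rank on stems. *)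

theory Submission
  imports Defs "HOL-Library.FuncSet"
begin

section \<open>Names for predictors\<close>

context forcing_notion
begin

lemma F_mem_mono:
  assumes "F_mem a \<tau> p" "q \<preceq> p" "p \<in> P" "q \<in> P"
  shows "F_mem a \<tau> q"
  using assms unfolding F_mem_def by (meson le_trans)

lemma F_ex_witness:
  assumes "F_ex \<Phi> p" "p \<in> P"
  obtains x q where "q \<in> P" "q \<preceq> p" "\<Phi> x q"
  using assms le_refl unfolding F_ex_def F_not_def F_all_def by blast

lemma F_imp_mp:
  assumes "F_imp \<phi> \<psi> p" "p \<in> P" "\<phi> p"
  obtains q where "q \<in> P" "q \<preceq> p" "\<psi> q"
  using assms le_refl unfolding F_imp_def F_not_def F_and_def by blast

lemma F_imp_mono:
  assumes "F_imp \<phi> \<psi> p" "q \<preceq> p" "p \<in> P" "q \<in> P"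
  shows "F_imp \<phi> \<psi> q"
  using assms unfolding F_imp_def F_not_def by (meson le_trans)

lemma predictor_name_unbounded:
  assumes "is_predictor_name \<pi>" "p \<in> P"
  obtains n q where "q \<in> P" "q \<preceq> p" "m \<le> n" "F_mem n (fst \<pi>) q"
proof -
  have "F_ex (\<lambda>n. F_and (F_ground (m \<le> n)) (F_mem n (fst \<pi>))) p"
    using assms by (simp add: is_predictor_name_def forced_def F_is_predictor_def F_and_def F_all_def)
  then show ?thesis
    using assms(2) that by (elim F_ex_witness) (auto simp: F_and_def F_ground_def)
qed

lemma predictor_name_value_unique:
  assumes "is_predictor_name \<pi>" "p \<in> P" "F_mem (length \<sigma>) (fst \<pi>) p"
  obtains v q where "q \<in> P" "q \<preceq> p" "F_mem (\<sigma>, v) (snd \<pi>) q"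
    "\<And>w. F_mem (\<sigma>, w) (snd \<pi>) q \<Longrightarrow> w = v"
proof -
  have "F_imp (F_mem (length \<sigma>) (fst \<pi>)) (F_ex1 (\<lambda>k. F_mem (\<sigma>, k) (snd \<pi>))) p"
    using assms by (simp add: is_predictor_name_def forced_def F_is_predictor_def F_and_def F_all_def)
  then obtain q where q: "q \<in> P" "q \<preceq> p" "F_ex1 (\<lambda>k. F_mem (\<sigma>, k) (snd \<pi>)) q"
    using assms(2,3) by (elim F_imp_mp)
  from q(3,1) obtain v r where r: "r \<in> P" "r \<preceq> q" "F_mem (\<sigma>, v) (snd \<pi>) r"
    "\<And>w. F_imp (F_mem (\<sigma>, w) (snd \<pi>)) (F_ground (w = v)) r"
    unfolding F_ex1_def by (elim F_ex_witness) (auto simp: F_and_def F_all_def)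
  show ?thesis
  proof
    show "r \<in> P" "r \<preceq> p" "F_mem (\<sigma>, v) (snd \<pi>) r"
      using r q assms(2) le_trans by blast+
    \<comment> \<open>\<open>F_imp\<close> only yields an extension forcing \<open>w = v\<close>,
      but a ground statement does not depend on the condition.\<close>
    show "w = v" if "F_mem (\<sigma>, w) (snd \<pi>) r" for w
      using F_imp_mp[OF r(4) r(1) that] by (auto simp: F_ground_def)
  qed
qed

lemma predictor_name_functional:
  assumes "is_predictor_name \<pi>" "p \<in> P" "F_mem (length \<sigma>) (fst \<pi>) p"
    and "F_mem (\<sigma>, v) (snd \<pi>) p" "F_mem (\<sigma>, w) (snd \<pi>) p"
  shows "v = w"
  using assms by (metis F_mem_mono predictor_name_value_unique)

text \<open>This is the matrix of \<open>F_predicts\<close> for one fixed \<open>m\<close>, with the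
  implication unfolded. \<open>F_imp\<close> is built from negations, so the correct value is only
  asked of some extension of each condition that puts \<open>n\<close> into the domain.\<close>

definition predicted_from :: "'p predictor_name \<Rightarrow> (nat \<Rightarrow> nat) \<Rightarrow> nat \<Rightarrow> 'p \<Rightarrow> bool" where
  "predicted_from \<pi> f m p \<longleftrightarrow> (\<forall>n\<ge>m. \<forall>q\<in>P. q \<preceq> p \<longrightarrow> F_mem n (fst \<pi>) q \<longrightarrow>
     (\<exists>r\<in>P. r \<preceq> q \<and> F_mem (restr f n, f n) (snd \<pi>) r))"

lemma predicted_from_mono:
  assumes "predicted_from \<pi> f m p" "q \<preceq> p" "p \<in> P" "q \<in> P"
  shows "predicted_from \<pi> f m q"
  using assms unfolding predicted_from_def by (meson le_trans)

lemma not_F_evades_predicted_from: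
  assumes "\<not> F_evades f \<pi> p" "p \<in> P"
  obtains m q where "q \<in> P" "predicted_from \<pi> f m q"
proof -
  obtain r where r: "r \<in> P" "F_predicts \<pi> f r"
    using assms by (auto simp: F_evades_def F_not_def)
  then obtain m q where q: "q \<in> P"
    "\<And>n. F_imp (F_and (F_ground (m \<le> n)) (F_mem n (fst \<pi>))) (F_mem (restr f n, f n) (snd \<pi>)) q"
    unfolding F_predicts_def by (elim F_ex_witness) (auto simp: F_all_def)
  have "predicted_from \<pi> f m q"
    unfolding predicted_from_def
  proof (intro allI ballI impI)
    fix n q' assume n: "m \<le> n" and q': "q' \<in> P" "q' \<preceq> q" "F_mem n (fst \<pi>) q'"
    have "F_imp (F_and (F_ground (m \<le> n)) (F_mem n (fst \<pi>))) (F_mem (restr f n, f n) (snd \<pi>)) q'"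
      using F_imp_mono q q' by blast
    then show "\<exists>r\<in>P. r \<preceq> q' \<and> F_mem (restr f n, f n) (snd \<pi>) r"
      using n q' by (elim F_imp_mp) (auto simp: F_and_def F_ground_def)
  qed
  with q(1) show ?thesis using that by blast
qed

end

section \<open>Deciding a prediction function below the identity\<close>

text \<open>This set of n! lists contains every restriction to \<open>n\<close> of a function below
  the identity.\<close>

definition below_id :: "nat \<Rightarrow> nat list set" where
  "below_id n = {\<sigma>. length \<sigma> = n \<and> (\<forall>i<n. \<sigma> ! i \<le> i)}"

lemma finite_below_id: "finite (below_id n)"
proof (rule finite_subset)
  show "below_id n \<subseteq> {xs. set xs \<subseteq> {..n} \<and> length xs = n}"
    by (fastforce simp: below_id_def in_set_conv_nth)
qed (rule finite_lists_length_eq, simp)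

lemma length_restr [simp]: "length (restr f n) = n"
  by (simp add: restr_def)

lemma restr_below_id: "(\<And>i. f i \<le> i) \<Longrightarrow> restr f n \<in> below_id n"
  by (simp add: below_id_def restr_def)

context forcing_notion
begin

text \<open>The value \<open>Suc n\<close> stands for all predictions above \<open>n\<close>, which
  are wrong for any function below the identity. The truncation leaves only finitely many candidates
  \<open>\<tau>\<close> on \<open>below_id n\<close>.\<close>

definition decides :: "'p predictor_name \<Rightarrow> nat \<Rightarrow> (nat list \<Rightarrow> nat) \<Rightarrow> 'p \<Rightarrow> bool" where
  "decides \<pi> n \<tau> q \<longleftrightarrow> F_mem n (fst \<pi>) q \<and>
     (\<forall>\<sigma>\<in>below_id n. \<exists>v. F_mem (\<sigma>, v) (snd \<pi>) q \<and> \<tau> \<sigma> = min v (Suc n))"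

text \<open>The finitely many values are fixed one after another, each by a further extension; those
  already fixed persist.\<close>

lemma exists_decides:
  assumes \<pi>: "is_predictor_name \<pi>" and p: "p \<in> P" "F_mem n (fst \<pi>) p"
  obtains q \<tau> where "q \<in> P" "q \<preceq> p" "\<tau> \<in> below_id n \<rightarrow>\<^sub>E {..Suc n}" "decides \<pi> n \<tau> q"
proof -
  have "\<exists>q\<in>P. q \<preceq> p \<and> (\<forall>\<sigma>\<in>S. \<exists>v. F_mem (\<sigma>, v) (snd \<pi>) q)" if "S \<subseteq> below_id n" for S
    using finite_subset[OF that finite_below_id] that
  proof (induction S rule: finite_induct)
    case empty
    then show ?case using p le_refl by blast
  next
    case (insert \<sigma> S)
    then obtain q where q: "q \<in> P" "q \<preceq> p" "\<forall>\<sigma>\<in>S. \<exists>v. F_mem (\<sigma>, v) (snd \<pi>) q"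
      by auto
    have "F_mem (length \<sigma>) (fst \<pi>) q"
      using insert.prems F_mem_mono[OF p(2) q(2) p(1) q(1)] by (simp add: below_id_def)
    then obtain v r where r: "r \<in> P" "r \<preceq> q" "F_mem (\<sigma>, v) (snd \<pi>) r"
      using predictor_name_value_unique[OF \<pi> q(1)] by metis
    have "\<forall>\<sigma>\<in>S. \<exists>v. F_mem (\<sigma>, v) (snd \<pi>) r"
      using q r F_mem_mono by meson
    moreover have "r \<preceq> p"
      using p q r le_trans by blast
    ultimately show ?case
      using r by blast
  qed
  then obtain q where q: "q \<in> P" "q \<preceq> p" "\<forall>\<sigma>\<in>below_id n. \<exists>v. F_mem (\<sigma>, v) (snd \<pi>) q"
    by blast
  then obtain V where V: "\<forall>\<sigma>\<in>below_id n. F_mem (\<sigma>, V \<sigma>) (snd \<pi>) q"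
    by metis
  have "decides \<pi> n (restrict (\<lambda>\<sigma>. min (V \<sigma>) (Suc n)) (below_id n)) q"
    using V F_mem_mono[OF p(2) q(2) p(1) q(1)] by (auto simp: decides_def)
  moreover have "restrict (\<lambda>\<sigma>. min (V \<sigma>) (Suc n)) (below_id n) \<in> below_id n \<rightarrow>\<^sub>E {..Suc n}"
    by auto
  ultimately show ?thesis
    using that q by blast
qed

lemma predicted_from_decides:
  assumes \<pi>: "is_predictor_name \<pi>" and f: "\<And>i. f i \<le> i"
    and p: "p \<in> P" "predicted_from \<pi> f m p" and q: "q \<in> P" "q \<preceq> p"
    and dec: "decides \<pi> n \<tau> q" and n: "m \<le> n"
  shows "f n = \<tau> (restr f n)"
proof -
  obtain v where v: "F_mem (restr f n, v) (snd \<pi>) q" "\<tau> (restr f n) = min v (Suc n)"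
    using dec restr_below_id[of f n] f by (auto simp: decides_def)
  have D: "F_mem n (fst \<pi>) q"
    using dec by (simp add: decides_def)
  then obtain r where r: "r \<in> P" "r \<preceq> q" "F_mem (restr f n, f n) (snd \<pi>) r"
    using p q n unfolding predicted_from_def by blast
  \<comment> \<open>\<open>r\<close> forces both \<open>v\<close> and \<open>f n\<close> to be the
    predicted value. Hence \<open>v\<close> is at most \<open>n\<close> and survives the
    truncation.\<close>
  have "f n = v"
    using predictor_name_functional[OF \<pi> r(1)] r F_mem_mono q D v(1) by (metis length_restr)
  then show ?thesis
    using v(2) f[of n] by simp
qed

end

section \<open>Stems of Hechler conditions\<close>

lemma Hechler_common_extension:
  assumes "(s, g) \<in> Hechler" "(s, h) \<in> Hechler"
  shows "(s, \<lambda>i. max (g i) (h i)) \<in> Hechler"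
  using assms
  by (auto simp: Hechler_def strict_mono_def intro: max.strict_coboundedI1 max.strict_coboundedI2)

lemma Hechler_finite_common_extension:
  assumes "finite T" "\<And>x. x \<in> T \<Longrightarrow> (s, G x) \<in> Hechler" "(s, g) \<in> Hechler"
  shows "\<exists>h. (s, h) \<in> Hechler \<and> (\<forall>x\<in>T. Hechler_le (s, h) (s, G x))"
  using assms(1,2)
proof (induction T rule: finite_induct)
  case empty
  then show ?case using assms(3) by auto
next
  case (insert x T)
  then obtain h where h: "(s, h) \<in> Hechler" "\<forall>x\<in>T. Hechler_le (s, h) (s, G x)"
    by auto
  have "(s, \<lambda>i. max (h i) (G x i)) \<in> Hechler"
    using h(1) insert.prems by (intro Hechler_common_extension) auto
  moreover have "\<forall>y\<in>insert x T. Hechler_le (s, \<lambda>i. max (h i) (G x i)) (s, G y)"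
    using h(2) by (auto simp: Hechler_le_def intro: le_trans max.coboundedI1)
  ultimately show ?case by blast
qed

section \<open>Lengthening the stem of a condition\<close>

lemma Hechler_stem_sorted: "(t, g) \<in> Hechler \<Longrightarrow> sorted_wrt (<) t"
  by (auto simp: Hechler_def sorted_wrt_iff_nth_less strict_mono_def)

lemma Hechler_extend_stem:
  assumes g: "(t, g) \<in> Hechler" and u: "prefix t u" "sorted_wrt (<) u"
    and ge: "\<And>i. length t \<le> i \<Longrightarrow> i < length u \<Longrightarrow> g i \<le> u ! i"
  obtains g' where "(u, g') \<in> Hechler" "Hechler_le (u, g') (t, g)"
proof
  \<comment> \<open>\<open>sum_list u\<close> bounds every entry of \<open>u\<close>, so the shift
    lifts the values beyond \<open>u\<close> above its last entry.\<close>
  define g' where "g' = (\<lambda>i. if i < length u then u ! i else g i + sum_list u)"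
  have sm: "strict_mono g" and gt: "\<And>i. i < length t \<Longrightarrow> t ! i = g i"
    using g by (auto simp: Hechler_def)
  have "g' i < g' j" if "i < j" for i j
  proof -
    have "g i < g j" using sm that by (simp add: strict_mono_less)
    moreover have "u ! i \<le> sum_list u" if "i < length u"
      using that by (simp add: member_le_sum_list)
    ultimately show ?thesis
      using that u(2) by (auto simp: g'_def sorted_wrt_iff_nth_less)
  qed
  then show "(u, g') \<in> Hechler"
    by (auto simp: Hechler_def g'_def strict_mono_def)
  have "g i \<le> u ! i" if "i < length u" for i
    using ge[of i] gt[of i] u(1) that by (cases "i < length t") (auto simp: prefix_def nth_append)
  then show "Hechler_le (u, g') (t, g)"
    using u(1) by (auto simp: Hechler_le_def g'_def)
qed

text \<open>The entries of \<open>u\<close> increase, so a large first new entry makes all new ones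
  large. The threshold depends on \<open>u\<close> only through its length.\<close>

lemma Hechler_extend_stem_large:
  assumes g: "(t, g) \<in> Hechler" and u: "prefix t u" "sorted_wrt (<) u"
    and ge: "g (length u) \<le> u ! length t"
  obtains g' where "(u, g') \<in> Hechler" "Hechler_le (u, g') (t, g)"
proof (rule Hechler_extend_stem[OF g u])
  show "g i \<le> u ! i" if i: "length t \<le> i" "i < length u" for i
  proof -
    have "g i \<le> g (length u)"
      using g i by (auto simp: Hechler_def strict_mono_less_eq)
    also have "\<dots> \<le> u ! length t" by (rule ge)
    also have "\<dots> \<le> u ! i"
      using i u(2) by (cases "i = length t") (auto simp: sorted_wrt_iff_nth_less intro: less_imp_le)
    finally show ?thesis .
  qed
qed

section \<open>Finite levels and fusion in the tree of stems\<close>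

lemma finite_bounded_branching:
  fixes c :: "nat list \<Rightarrow> nat"
  shows "finite {t. prefix s t \<and> length t = l \<and> (\<forall>i. length s \<le> i \<and> i < l \<longrightarrow> t ! i < c (take i t))}"
    (is "finite (?T l)")
proof (induction l)
  case 0
  show ?case by (rule finite_subset[of _ "{[]}"]) auto
next
  case (Suc l)
  \<comment> \<open>Every stem on the new level other than \<open>s\<close> arises by appending a
    bounded entry; \<open>s\<close> is listed separately because its initial segment no longer
    extends \<open>s\<close>.\<close>
  have "?T (Suc l) \<subseteq> insert s (\<Union>t\<in>?T l. (\<lambda>x. t @ [x]) ` {..<c t})"
  proof
    fix t assume t: "t \<in> ?T (Suc l)"
    show "t \<in> insert s (\<Union>t\<in>?T l. (\<lambda>x. t @ [x]) ` {..<c t})"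
    proof (cases "t = s")
      case False
      obtain t' x where t': "t = t' @ [x]" "length t' = l"
        using t by (cases t rule: rev_cases) auto
      with t False have pre: "prefix s t'" by auto
      have "t' ! i < c (take i t')" if "length s \<le> i" "i < l" for i
        using t t' that by (auto simp: nth_append dest!: spec[of _ i])
      moreover have "x < c t'"
        using t t' pre prefix_length_le[OF pre] by (auto dest!: spec[of _ l])
      ultimately show ?thesis using t' pre by auto
    qed simp
  qed
  then show ?case by (rule finite_subset) (use Suc in auto)
qed

text \<open>The fusion argument: a set of stems none of which is a limit of \<open>Good\<close> stems is
  left by no extension of a suitable condition. For the stems of length \<open>l + 1\<close>, only the finitely
  many stems of length \<open>l\<close> whose entries stay below the bounds for that length matter.\<close>

lemma Hechler_avoid:
  assumes g: "(s, g) \<in> Hechler" and s: "\<not> Good s"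
    and bound: "\<And>t l. \<lbrakk>prefix s t; sorted_wrt (<) t; \<And>i. length s \<le> i \<Longrightarrow> i < length t \<Longrightarrow> g i \<le> t ! i;
        \<not> Good t; length t < l\<rbrakk> \<Longrightarrow>
      \<exists>b. \<forall>u. prefix t u \<longrightarrow> length u = l \<longrightarrow> sorted_wrt (<) u \<longrightarrow> Good u \<longrightarrow> u ! length t < b"
  obtains h where "(s, h) \<in> Hechler"
    "\<And>u h'. (u, h') \<in> Hechler \<Longrightarrow> Hechler_le (u, h') (s, h) \<Longrightarrow> \<not> Good u"
proof -
  \<comment> \<open>By \<open>Hechler_extend_stem\<close>, these are exactly the stems of conditions
    below \<open>(s, g)\<close>.\<close>
  define elig where "elig t \<longleftrightarrow> prefix s t \<and> sorted_wrt (<) t \<and>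
    (\<forall>i. length s \<le> i \<longrightarrow> i < length t \<longrightarrow> g i \<le> t ! i)" for t
  have "\<exists>b. elig t \<longrightarrow> \<not> Good t \<longrightarrow> length t < l \<longrightarrow>
      (\<forall>u. prefix t u \<longrightarrow> length u = l \<longrightarrow> sorted_wrt (<) u \<longrightarrow> Good u \<longrightarrow> u ! length t < b)" for t l
    using bound[of t l] unfolding elig_def by blast
  then obtain b where b: "\<And>t l u. \<lbrakk>elig t; \<not> Good t; length t < l; prefix t u; length u = l;
      sorted_wrt (<) u; Good u\<rbrakk> \<Longrightarrow> u ! length t < b t l"
    by metis
  \<comment> \<open>\<open>T l\<close> uses the bounds for length \<open>Suc l\<close>: it contains
    the first \<open>l\<close> entries of each \<open>Good\<close> stem of length
    \<open>Suc l\<close> whose proper initial segments extending \<open>s\<close> are eligible and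
    not \<open>Good\<close>.\<close>
  define T where "T l = {t. prefix s t \<and> length t = l \<and>
    (\<forall>i. length s \<le> i \<and> i < l \<longrightarrow> t ! i < b (take i t) (Suc l))}" for l
  have finT: "finite (T l)" for l
    unfolding T_def by (rule finite_bounded_branching)
  \<comment> \<open>From \<open>length s\<close> on, \<open>h l\<close> dominates all bounds
    attached to \<open>T l\<close>. Accumulating the sums keeps \<open>h\<close> strictly
    increasing, and they are empty below \<open>length s\<close>, so \<open>h\<close> still extends
    \<open>s\<close>.\<close>
  define h where "h i = g i + (\<Sum>l\<in>{length s..i}. \<Sum>t\<in>T l. b t (Suc l))" for i
  have "h i < h j" if "i < j" for i j
  proof -
    have "g i < g j" using g that by (auto simp: Hechler_def strict_mono_def)
    moreover have "(\<Sum>l\<in>{length s..i}. \<Sum>t\<in>T l. b t (Suc l)) \<le> (\<Sum>l\<in>{length s..j}. \<Sum>t\<in>T l. b t (Suc l))"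
      using that by (intro sum_mono2) auto
    ultimately show ?thesis unfolding h_def by linarith
  qed
  then have hH: "(s, h) \<in> Hechler"
    using g by (auto simp: Hechler_def h_def strict_mono_def)
  have b_le_h: "b t (Suc l) \<le> h l" if "t \<in> T l" "length s \<le> l" for t l
  proof -
    have "b t (Suc l) \<le> (\<Sum>t\<in>T l. b t (Suc l))"
      using that finT by (intro member_le_sum) auto
    also have "\<dots> \<le> (\<Sum>l\<in>{length s..l}. \<Sum>t\<in>T l. b t (Suc l))"
      using that by (intro member_le_sum[of l _ "\<lambda>l. \<Sum>t\<in>T l. b t (Suc l)"]) auto
    finally show ?thesis by (simp add: h_def)
  qed
  have avoid: "\<not> Good u" if "prefix s u" "sorted_wrt (<) u"
      "\<And>i. length s \<le> i \<Longrightarrow> i < length u \<Longrightarrow> h i \<le> u ! i" for u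
    using that
  proof (induction "length u" arbitrary: u rule: less_induct)
    case less
    show ?case
    proof (cases "u = s")
      case False
      with less.prems(1) have "length s < length u"
        by (simp add: prefix_length_less strict_prefix_def)
      then obtain l where l: "length u = Suc l" "length s \<le> l"
        by (cases "length u") auto
      have pre: "elig (take i u) \<and> \<not> Good (take i u)" if i: "length s \<le> i" "i \<le> l" for i
      proof -
        have ps: "prefix s (take i u)"
          using less.prems(1) i l by (metis le_Suc_eq length_take min.absorb2 prefix_length_prefix take_is_prefix)
        have so: "sorted_wrt (<) (take i u)"
          using less.prems(2) by (rule sorted_wrt_take)
        have "h j \<le> take i u ! j" if "length s \<le> j" "j < length (take i u)" for j
          using less.prems(3)[of j] that by auto
        moreover from this have "g j \<le> take i u ! j" if "length s \<le> j" "j < length (take i u)" for j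
          using that unfolding h_def by (meson add_leD1)
        ultimately show ?thesis
          using less.hyps[of "take i u"] ps so i l by (auto simp: elig_def)
      qed
      \<comment> \<open>Each \<open>take i u\<close> is not \<open>Good\<close>, so a
        \<open>Good\<close> \<open>u\<close> has entry \<open>i\<close> below the corresponding
        bound. At \<open>i = l\<close> this will contradict \<open>h l \<le> u ! l\<close>.\<close>
      have lt: "u ! i < b (take i u) (Suc l)" if "Good u" "length s \<le> i" "i \<le> l" for i
        using b[of "take i u" "Suc l" u] pre[of i] that l less.prems(2) by (auto simp: take_is_prefix)
      show ?thesis
      proof
        assume G: "Good u"
        have "take l u \<in> T l"
          using pre[of l] lt[OF G] l by (auto simp: T_def elig_def min_def)
        then have "b (take l u) (Suc l) \<le> u ! l"
          using b_le_h[of "take l u" l] less.prems(3)[of l] l by auto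
        then show False
          using lt[OF G, of l] l by simp
      qed
    qed (use s in simp)
  qed
  show ?thesis
  proof (rule that[OF hH])
    fix u h' assume u: "(u, h') \<in> Hechler" "Hechler_le (u, h') (s, h)"
    show "\<not> Good u"
    proof (rule avoid)
      show "prefix s u" "sorted_wrt (<) u"
        using u Hechler_stem_sorted by (auto simp: Hechler_le_def)
      show "h i \<le> u ! i" if "i < length u" for i
        using u that by (auto simp: Hechler_def Hechler_le_def)
    qed
  qed
qed

section \<open>Ground model predictors from stems\<close>

text \<open>Equivalently, no condition with stem \<open>s\<close> forces \<open>n\<close> out of the
  domain; the stem of \<open>q\<close> may be longer.\<close>

definition favors :: "(nat list \<times> (nat \<Rightarrow> nat)) predictor_name \<Rightarrow> nat list \<Rightarrow> nat \<Rightarrow> bool" where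
  "favors \<pi> s n \<longleftrightarrow>
     (\<forall>g. (s, g) \<in> Hechler \<longrightarrow> (\<exists>q\<in>Hechler. Hechler_le q (s, g) \<and> Hechler.F_mem n (fst \<pi>) q))"

text \<open>The predictor must serve all \<open>g\<close> at once. It then depends only on the name,
  \<open>t\<close> and \<open>m\<close>, which leaves countably many cases.\<close>

definition stem_predicts ::
  "(nat list \<times> (nat \<Rightarrow> nat)) predictor_name \<Rightarrow> nat list \<Rightarrow> nat \<Rightarrow> predictor \<Rightarrow> bool" where
  "stem_predicts \<pi> t m \<rho> \<longleftrightarrow> is_predictor \<rho> \<and>
     (\<forall>f g. (\<forall>i. f i \<le> i) \<longrightarrow> (t, g) \<in> Hechler \<longrightarrow> Hechler.predicted_from \<pi> f m (t, g) \<longrightarrow> predicts \<rho> f)"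

text \<open>If every \<open>\<tau>\<close> were refuted by some condition with stem
  \<open>s\<close>, a common extension of the finitely many relevant ones would refute them all, yet
  some condition below it decides one of them.\<close>

lemma favors_decides:
  assumes \<pi>: "Hechler.is_predictor_name \<pi>" and s: "favors \<pi> s n"
  shows "\<exists>\<tau>. \<forall>g. (s, g) \<in> Hechler \<longrightarrow>
    (\<exists>q\<in>Hechler. Hechler_le q (s, g) \<and> Hechler.decides \<pi> n \<tau> q)"
proof (rule ccontr)
  assume "\<not> ?thesis"
  then obtain G where G: "\<And>\<tau>. (s, G \<tau>) \<in> Hechler"
    "\<And>\<tau> q. q \<in> Hechler \<Longrightarrow> Hechler_le q (s, G \<tau>) \<Longrightarrow> \<not> Hechler.decides \<pi> n \<tau> q"
    by metis
  have "finite (below_id n \<rightarrow>\<^sub>E {..Suc n})"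
    by (intro finite_PiE finite_below_id) auto
  then obtain h where h: "(s, h) \<in> Hechler"
    "\<forall>\<tau>\<in>below_id n \<rightarrow>\<^sub>E {..Suc n}. Hechler_le (s, h) (s, G \<tau>)"
    using Hechler_finite_common_extension G(1) by metis
  then obtain p where p: "p \<in> Hechler" "Hechler_le p (s, h)" "Hechler.F_mem n (fst \<pi>) p"
    using s unfolding favors_def by blast
  then obtain q \<tau> where q: "q \<in> Hechler" "Hechler_le q p" "\<tau> \<in> below_id n \<rightarrow>\<^sub>E {..Suc n}"
    "Hechler.decides \<pi> n \<tau> q"
    using Hechler.exists_decides[OF \<pi>] by metis
  have "Hechler_le q (s, G \<tau>)"
    using p q h G(1) Hechler.le_trans by meson
  then show False
    using G(2) q by blast
qed

lemma favors_predicted_value: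
  assumes "Hechler.is_predictor_name \<pi>" "favors \<pi> s n"
  obtains \<tau> where "\<And>f g m. \<lbrakk>\<And>i. f i \<le> i; (s, g) \<in> Hechler; Hechler.predicted_from \<pi> f m (s, g); m \<le> n\<rbrakk>
    \<Longrightarrow> f n = \<tau> (restr f n)"
  using favors_decides[OF assms] Hechler.predicted_from_decides[OF assms(1)] by metis

section \<open>Predictors from a single stem and from a limit of stems\<close>

lemma stem_predicts_if_favors_infinite:
  assumes \<pi>: "Hechler.is_predictor_name \<pi>" and inf: "infinite {n. favors \<pi> s n}"
  shows "\<exists>\<rho>. stem_predicts \<pi> s m \<rho>"
proof -
  have "\<exists>\<tau>. favors \<pi> s n \<longrightarrow> (\<forall>f g m. (\<forall>i. f i \<le> i) \<longrightarrow> (s, g) \<in> Hechler \<longrightarrow>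
      Hechler.predicted_from \<pi> f m (s, g) \<longrightarrow> m \<le> n \<longrightarrow> f n = \<tau> (restr f n))" for n
    using favors_predicted_value[OF \<pi>, of s n] by metis
  then obtain \<tau> where \<tau>: "\<And>n f g m. \<lbrakk>favors \<pi> s n; \<forall>i. f i \<le> i; (s, g) \<in> Hechler;
      Hechler.predicted_from \<pi> f m (s, g); m \<le> n\<rbrakk> \<Longrightarrow> f n = \<tau> n (restr f n)"
    by metis
  have "predicts ({n. favors \<pi> s n}, \<lambda>\<sigma>. \<tau> (length \<sigma>) \<sigma>) f"
    if f: "\<forall>i. f i \<le> i" "(s, g) \<in> Hechler" "Hechler.predicted_from \<pi> f m (s, g)" for f g
  proof -
    have "{n \<in> {n. favors \<pi> s n}. f n \<noteq> \<tau> n (restr f n)} \<subseteq> {..<m}"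
      using \<tau>[OF _ f] by (auto simp: not_le[symmetric])
    then show ?thesis
      by (simp add: predicts_def) (metis finite_subset finite_lessThan)
  qed
  then have "stem_predicts \<pi> s m ({n. favors \<pi> s n}, \<lambda>\<sigma>. \<tau> (length \<sigma>) \<sigma>)"
    using inf by (auto simp: stem_predicts_def is_predictor_def)
  then show ?thesis ..
qed

text \<open>Because the stems in \<open>lim\<close> share the length \<open>l\<close>, the single
  number \<open>g l\<close> tells from which index on they fit below \<open>(t, g)\<close>. The
  assumption \<open>m \<le> k\<close> places all witnesses past the start of the prediction.\<close>

lemma stem_predicts_if_limit:
  assumes \<pi>: "Hechler.is_predictor_name \<pi>" and mk: "m \<le> k"
    and bad: "\<And>n. k \<le> n \<Longrightarrow> \<not> favors \<pi> t n"
    and lim: "\<And>b. \<exists>u n. prefix t u \<and> length u = l \<and> sorted_wrt (<) u \<and> b \<le> u ! length t \<and>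
      k \<le> n \<and> favors \<pi> u n"
  shows "\<exists>\<rho>. stem_predicts \<pi> t m \<rho>"
proof -
  obtain U N where U: "\<And>b. prefix t (U b)" "\<And>b. length (U b) = l" "\<And>b. sorted_wrt (<) (U b)"
      "\<And>b. b \<le> U b ! length t" and N: "\<And>b. k \<le> N b" "\<And>b. favors \<pi> (U b) (N b)"
    using lim by metis
  have ext: "\<exists>g'. (U b, g') \<in> Hechler \<and> Hechler_le (U b, g') (t, g)"
    if g: "(t, g) \<in> Hechler" and b: "g l \<le> b" for g b
  proof -
    have "g (length (U b)) \<le> U b ! length t"
      using b U(2,4)[of b] by simp
    then show ?thesis
      using Hechler_extend_stem_large[OF g U(1,3)] by metis
  qed
  \<comment> \<open>If \<open>n\<close> were a witness infinitely often, each \<open>(t, g)\<close>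
    would have an extension with stem \<open>U b\<close> and \<open>N b = n\<close>, so
    \<open>t\<close> itself would favor \<open>n\<close>.\<close>
  have fib: "finite {b. N b = n}" for n
  proof (rule ccontr)
    assume inf: "infinite {b. N b = n}"
    have "favors \<pi> t n"
      unfolding favors_def
    proof (intro allI impI)
      fix g assume g: "(t, g) \<in> Hechler"
      obtain b where b: "g l \<le> b" "N b = n"
        using inf unfolding infinite_nat_iff_unbounded_le by blast
      with ext[OF g] obtain g' where g': "(U b, g') \<in> Hechler" "Hechler_le (U b, g') (t, g)"
        by blast
      then obtain q where "q \<in> Hechler" "Hechler_le q (U b, g')" "Hechler.F_mem n (fst \<pi>) q"
        using N(2)[of b] b unfolding favors_def by blast
      then show "\<exists>q\<in>Hechler. Hechler_le q (t, g) \<and> Hechler.F_mem n (fst \<pi>) q"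
        using g g' Hechler.le_trans by blast
    qed
    moreover have "k \<le> n"
      using inf N(1) not_finite_existsD by blast
    ultimately show False using bad by blast
  qed
  have infN: "infinite (range N)"
  proof
    assume "finite (range N)"
    then have "finite (\<Union>n\<in>range N. {b. N b = n})"
      using fib by blast
    moreover have "(\<Union>n\<in>range N. {b. N b = n}) = UNIV" by auto
    ultimately show False by simp
  qed
  have "\<exists>\<tau>. \<forall>f g m. (\<forall>i. f i \<le> i) \<longrightarrow> (U b, g) \<in> Hechler \<longrightarrow>
      Hechler.predicted_from \<pi> f m (U b, g) \<longrightarrow> m \<le> N b \<longrightarrow> f (N b) = \<tau> (restr f (N b))" for b
    using favors_predicted_value[OF \<pi> N(2)[of b]] by metis
  then obtain \<tau> where \<tau>: "\<And>b f g m. \<lbrakk>\<forall>i. f i \<le> i; (U b, g) \<in> Hechler;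
      Hechler.predicted_from \<pi> f m (U b, g); m \<le> N b\<rbrakk> \<Longrightarrow> f (N b) = \<tau> b (restr f (N b))"
    by metis
  \<comment> \<open>\<open>N\<close> may repeat values, so one index is chosen for each level in its
    range.\<close>
  define B where "B = inv N"
  have B: "N (B n) = n" if "n \<in> range N" for n
    using that by (simp add: B_def f_inv_into_f)
  have "predicts (range N, \<lambda>\<sigma>. \<tau> (B (length \<sigma>)) \<sigma>) f"
    if f: "\<forall>i. f i \<le> i" and g: "(t, g) \<in> Hechler" "Hechler.predicted_from \<pi> f m (t, g)" for f g
  proof -
    \<comment> \<open>An error at \<open>n\<close> requires \<open>B n < g l\<close>; otherwise
      \<open>U (B n)\<close> is the stem of a condition below \<open>(t, g)\<close>, and that
      condition inherits the prediction.\<close>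
    have "n \<in> N ` {..<g l}" if n: "n \<in> range N" "f n \<noteq> \<tau> (B n) (restr f n)" for n
    proof (rule ccontr)
      assume "n \<notin> N ` {..<g l}"
      then have "g l \<le> B n"
        using B[OF n(1)] by (metis imageI lessThan_iff not_le)
      with ext[OF g(1)] obtain g' where g': "(U (B n), g') \<in> Hechler" "Hechler_le (U (B n), g') (t, g)"
        by blast
      have "Hechler.predicted_from \<pi> f m (U (B n), g')"
        using Hechler.predicted_from_mono g g' by blast
      then have "f n = \<tau> (B n) (restr f n)"
        using \<tau>[OF f g'(1)] B[OF n(1)] N(1)[of "B n"] mk by simp
      with n show False by simp
    qed
    then have "{n \<in> range N. f n \<noteq> \<tau> (B n) (restr f n)} \<subseteq> N ` {..<g l}"
      by blast
    then have "finite {n \<in> range N. f n \<noteq> \<tau> (B n) (restr f n)}"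
      by (rule finite_subset) simp
    then show ?thesis
      by (simp add: predicts_def)
  qed
  then have "stem_predicts \<pi> t m (range N, \<lambda>\<sigma>. \<tau> (B (length \<sigma>)) \<sigma>)"
    using infN by (auto simp: stem_predicts_def is_predictor_def)
  then show ?thesis ..
qed

text \<open>Density makes it possible to move from any condition forcing a prediction to one whose
  stem has a ground model predictor.\<close>

lemma dense_stem_predicts:
  assumes \<pi>: "Hechler.is_predictor_name \<pi>" and g: "(s, g) \<in> Hechler"
  shows "\<exists>t g' \<rho>. (t, g') \<in> Hechler \<and> Hechler_le (t, g') (s, g) \<and> stem_predicts \<pi> t m \<rho>"
proof (cases "infinite {n. favors \<pi> s n}")
  case True
  then show ?thesis
    using g Hechler.le_refl[OF g] stem_predicts_if_favors_infinite[OF \<pi>] by blast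
next
  case False
  then obtain k0 where k0: "\<And>n. favors \<pi> s n \<Longrightarrow> n < k0"
    using finite_nat_set_iff_bounded by auto
  \<comment> \<open>Past \<open>k0\<close> nothing is favored by \<open>s\<close>, and past
    \<open>m\<close> the prediction is in force.\<close>
  define k where "k = max k0 m"
  define Good where "Good t \<longleftrightarrow> (\<exists>n\<ge>k. favors \<pi> t n)" for t
  have s: "\<not> Good s"
    using k0 by (force simp: Good_def k_def)
  show ?thesis
  proof (rule ccontr)
    assume none: "\<not> ?thesis"
    obtain h where h: "(s, h) \<in> Hechler"
      "\<And>u h'. (u, h') \<in> Hechler \<Longrightarrow> Hechler_le (u, h') (s, h) \<Longrightarrow> \<not> Good u"
    proof (rule Hechler_avoid[where Good = Good, OF g s])
      fix t l
      assume t: "prefix s t" "sorted_wrt (<) t"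
        "\<And>i. length s \<le> i \<Longrightarrow> i < length t \<Longrightarrow> g i \<le> t ! i" "\<not> Good t"
      \<comment> \<open>\<open>t\<close> is the stem of a condition below \<open>(s, g)\<close>, so
        a predictor for \<open>t\<close> would contradict \<open>none\<close>.\<close>
      obtain g' where g': "(t, g') \<in> Hechler" "Hechler_le (t, g') (s, g)"
        using Hechler_extend_stem[OF g t(1-3)] by blast
      show "\<exists>b. \<forall>u. prefix t u \<longrightarrow> length u = l \<longrightarrow> sorted_wrt (<) u \<longrightarrow> Good u \<longrightarrow> u ! length t < b"
      proof (rule ccontr)
        assume "\<not> ?thesis"
        then have "\<exists>u n. prefix t u \<and> length u = l \<and> sorted_wrt (<) u \<and> b \<le> u ! length t \<and>
            k \<le> n \<and> favors \<pi> u n" for b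
          unfolding Good_def not_less[symmetric] by metis
        then have "\<exists>\<rho>. stem_predicts \<pi> t m \<rho>"
          using t(4) by (intro stem_predicts_if_limit[OF \<pi>, of m k]) (auto simp: Good_def k_def)
        then show False
          using g' none by blast
      qed
    qed blast
    obtain n r where r: "r \<in> Hechler" "Hechler_le r (s, h)" "k \<le> n" "Hechler.F_mem n (fst \<pi>) r"
      using Hechler.predictor_name_unbounded[OF \<pi> h(1)] by metis
    obtain u h' where u: "r = (u, h')"
      by fastforce
    \<comment> \<open>Every condition with stem \<open>u\<close> is compatible with
      \<open>r\<close>, which forces \<open>n\<close> into the domain. Thus \<open>u\<close> is
      \<open>Good\<close>, although it lies below \<open>(s, h)\<close>.\<close>
    have "favors \<pi> u n"
      unfolding favors_def
    proof (intro allI impI)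
      fix g'' assume g'': "(u, g'') \<in> Hechler"
      let ?q = "(u, \<lambda>i. max (h' i) (g'' i))"
      have q: "?q \<in> Hechler" "Hechler_le ?q (u, g'')" "Hechler_le ?q r"
        using Hechler_common_extension g'' r(1) by (auto simp: u Hechler_le_def)
      then show "\<exists>q\<in>Hechler. Hechler_le q (u, g'') \<and> Hechler.F_mem n (fst \<pi>) q"
        using Hechler.F_mem_mono[OF r(4)] r(1) by blast
    qed
    then show False
      using h(2) r u by (auto simp: Good_def)
  qed
qed

theorem mainTheorem6: "forcing_notion.star_star Hechler Hechler_le"
  unfolding Hechler.star_star_def
proof (intro allI impI)
  fix F :: "(nat \<Rightarrow> nat) set" and \<pi>' :: "nat \<Rightarrow> (nat list \<times> (nat \<Rightarrow> nat)) predictor_name"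
  assume below: "\<forall>f\<in>F. \<forall>n. f n \<le> n" and names: "\<forall>n. Hechler.is_predictor_name (\<pi>' n)"
  \<comment> \<open>The triples \<open>(n, t, m)\<close> form a countable type and can be enumerated
    by \<open>from_nat\<close>. The default has domain \<open>UNIV\<close>, so every entry of the
    sequence is a predictor.\<close>
  define \<rho> where "\<rho> = (\<lambda>(n, t, m). if \<exists>\<rho>. stem_predicts (\<pi>' n) t m \<rho>
    then SOME \<rho>. stem_predicts (\<pi>' n) t m \<rho> else (UNIV, \<lambda>_. 0))"
  have \<rho>: "stem_predicts (\<pi>' n) t m (\<rho> (n, t, m))" if "stem_predicts (\<pi>' n) t m \<rho>'" for n t m \<rho>'
  proof -
    have "\<exists>\<rho>. stem_predicts (\<pi>' n) t m \<rho>"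
      using that by blast
    then show ?thesis
      unfolding \<rho>_def by (simp only: prod.case if_True) (rule someI_ex)
  qed
  have \<rho>_predictor: "is_predictor (\<rho> x)" for x
  proof (cases x)
    case (fields n t m)
    show ?thesis
    proof (cases "\<exists>\<rho>. stem_predicts (\<pi>' n) t m \<rho>")
      case True
      then show ?thesis using \<rho> fields unfolding stem_predicts_def by blast
    qed (simp add: fields \<rho>_def is_predictor_def)
  qed
  show "\<exists>\<pi> :: nat \<Rightarrow> predictor. (\<forall>n. is_predictor (\<pi> n)) \<and> (\<forall>f\<in>F. (\<forall>n. evades f (\<pi> n)) \<longrightarrow>
      Hechler.forced (Hechler.F_all (\<lambda>n. Hechler.F_evades f (\<pi>' n))))"
  proof (rule exI[of _ "\<lambda>j. \<rho> (from_nat j)"], intro conjI ballI impI allI)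
    fix f assume f: "f \<in> F" and ev: "\<forall>j. evades f (\<rho> (from_nat j))"
    have "Hechler.F_evades f (\<pi>' n) p" if p: "p \<in> Hechler" for n p
    proof (rule ccontr)
      assume "\<not> ?thesis"
      then obtain m q where q: "q \<in> Hechler" "Hechler.predicted_from (\<pi>' n) f m q"
        using p by (rule Hechler.not_F_evades_predicted_from)
      obtain s g where sg: "q = (s, g)"
        by fastforce
      obtain t g' \<rho>' where t: "(t, g') \<in> Hechler" "Hechler_le (t, g') (s, g)"
        "stem_predicts (\<pi>' n) t m \<rho>'"
        using dense_stem_predicts names q(1) sg by metis
      have "Hechler.predicted_from (\<pi>' n) f m (t, g')"
        using Hechler.predicted_from_mono q sg t by blast
      then have "predicts (\<rho> (n, t, m)) f"
        using \<rho>[OF t(3)] t(1) below f unfolding stem_predicts_def by blast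
      moreover have "evades f (\<rho> (n, t, m))"
        using ev by (metis from_nat_to_nat)
      ultimately show False
        by (simp add: evades_def)
    qed
    then show "Hechler.forced (Hechler.F_all (\<lambda>n. Hechler.F_evades f (\<pi>' n)))"
      by (simp add: Hechler.forced_def Hechler.F_all_def)
  qed (rule \<rho>_predictor)
qed

end
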